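(* Let $\lambda$ be a nonzero real number and $r\ge 0$ an integer. For every integer $n\ge 0$, $$(x)_{n,\lambda}=\frac{1}{2(n+r)_{r}}\bigg(\sum_{l=0}^{n}\binom{n+r}{l+r}(1)_{n-l,\lambda}A_{l+r,\lambda}^{(r)}(x)+A_{n+r,\lambda}^{(r)}(x)\bigg).$$
   Context: For nonzero real $\lambda$, the generalized falling factorials are $(x)_{0,\lambda}=1$ and $(x)_{n,\lambda}=x(x-\lambda)\cdots(x-(n-1)\lambda)$ for $n\ge1$. The degenerate exponential is $e_\lambda^x(t)=(1+\lambda t)^{x/\lambda}=\sum_{n\ge0}(x)_{n,\lambda}\frac{t^n}{n!}$, and $e_\lambda(t)=e_\lambda^1(t)$. The ordinary falling factorial is $(y)_0=1$, $(y)_r=y(y-1)\cdots(y-r+1)$ for $r\ge1$. For an integer $r\ge0$, the generalized degenerate Euler-Genocchi polynomials $A_{n,\lambda}^{(r)}(x)$ are defined by the generating function $\frac{2t^{r}}{e_{\lambda}(t)+1}e_{\lambda}^{x}(t)=\sum_{n=0}^{\infty}A_{n,\lambda}^{(r)}(x)\frac{t^{n}}{n!}$. *)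

theory Defs
  imports Complex_Main "HOL-Computational_Algebra.Formal_Power_Series"
begin

unbundle fps_syntax

definition falling_factorial :: "real \<Rightarrow> nat \<Rightarrow> real" where
  "falling_factorial y r = (\<Prod>i<r. y - real i)"

definition gen_falling_factorial :: "real \<Rightarrow> real \<Rightarrow> nat \<Rightarrow> real" where
  "gen_falling_factorial lam x n = (\<Prod>i<n. x - real i * lam)"

text \<open>The degenerate exponential \<open>(1 + \<lambda>t)\<close> to the power \<open>x/\<lambda>\<close>,
  as a formal power series in \<open>t\<close>.\<close>

definition deg_exp :: "real \<Rightarrow> real \<Rightarrow> real fps" where
  "deg_exp lam x = Abs_fps (\<lambda>n. gen_falling_factorial lam x n / fact n)"

lemma deg_exp_eq_binomial:
  assumes "lam \<noteq> 0"
  shows "deg_exp lam x = fps_compose (fps_binomial (x / lam)) (fps_const lam * fps_X)"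
proof (rule fps_ext)
  fix n
  have "gen_falling_factorial lam x n = (\<Prod>i<n. lam * (x / lam - real i))"
    unfolding gen_falling_factorial_def using assms
    by (intro prod.cong) (auto simp: field_simps)
  also have "\<dots> = lam ^ n * (\<Prod>i<n. x / lam - real i)"
    by (simp add: prod.distrib)
  finally show "deg_exp lam x $ n =
      fps_compose (fps_binomial (x / lam)) (fps_const lam * fps_X) $ n"
    by (simp add: deg_exp_def fps_compose_linear gbinomial_prod_rev
        atLeast0LessThan)
qed

text \<open>The generating function is a quotient of formal power series whose denominator has
  constant term 2, hence is a unit. The polynomials are given through their values at real
  \<open>x\<close>.\<close>

definition euler_genocchi_gf :: "real \<Rightarrow> nat \<Rightarrow> real \<Rightarrow> real fps" where
  "euler_genocchi_gf lam r x = (2 * fps_X ^ r) / (deg_exp lam 1 + 1) * deg_exp lam x"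

definition euler_genocchi :: "real \<Rightarrow> nat \<Rightarrow> nat \<Rightarrow> real \<Rightarrow> real" where
  "euler_genocchi lam r n x = fact n * euler_genocchi_gf lam r x $ n"

lemma euler_genocchi_gf_eq:
  "euler_genocchi_gf lam r x = Abs_fps (\<lambda>n. euler_genocchi lam r n x / fact n)"
  by (rule fps_ext) (simp add: euler_genocchi_def)

lemma euler_genocchi_gf_mult:
  "euler_genocchi_gf lam r x * (deg_exp lam 1 + 1) = 2 * fps_X ^ r * deg_exp lam x"
proof -
  have "(deg_exp lam 1 + 1) $ 0 \<noteq> 0"
    by (simp add: deg_exp_def gen_falling_factorial_def)
  then have "inverse (deg_exp lam 1 + 1) * (deg_exp lam 1 + 1) = 1"
    and "(2 * fps_X ^ r) / (deg_exp lam 1 + 1) =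
      2 * fps_X ^ r * inverse (deg_exp lam 1 + 1)"
    by (simp_all add: inverse_mult_eq_1 fps_divide_unit)
  then show ?thesis
    by (simp add: euler_genocchi_gf_def mult.assoc mult.left_commute)
qed

end

theory Submission
  imports Defs
begin

text \<open>Since the generating function is divisible by \<open>X ^ r\<close>, cancelling \<open>X ^ r\<close> in
  \<open>euler_genocchi_gf_mult\<close> and comparing coefficients of \<open>t ^ n\<close> gives the identity, after
  multiplication by \<open>(n + r)!\<close>.\<close>

text \<open>With the prefactor as a quotient of factorials, the final step only has to cancel
  \<open>fact (n + r)\<close>.\<close>

lemma falling_factorial_eq_fact_div:
  "falling_factorial (real (n + r)) r = fact (n + r) / fact n"
proof (induction r)
  case 0
  show ?case by (simp add: falling_factorial_def)
next
  case (Suc r)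
  have "falling_factorial (real (n + Suc r)) (Suc r) =
      real (n + Suc r) * falling_factorial (real (n + r)) r"
    unfolding falling_factorial_def
    \<comment> \<open>Split off the factor at index 0, the largest one; shifting the index in the
      others gives the product for \<open>n + r\<close>.\<close>
    by (subst prod.lessThan_Suc_shift) (simp add: algebra_simps)
  also have "\<dots> = fact (n + Suc r) / fact n"
    by (simp add: Suc.IH del: of_nat_add)
  finally show ?case .
qed

text \<open>This replaces an explicit cancellation of \<open>fps_X ^ r\<close>: all orders reduce to
  order 0, since dividing by a unit is multiplying by its inverse.\<close>

lemma euler_genocchi_gf_eq_X_power_mult:
  "euler_genocchi_gf lam r x = fps_X ^ r * euler_genocchi_gf lam 0 x"
proof -
  have "(deg_exp lam 1 + 1) $ 0 \<noteq> 0"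
    by (simp add: deg_exp_def gen_falling_factorial_def)
  then show ?thesis
    by (simp add: euler_genocchi_gf_def fps_divide_unit algebra_simps)
qed

lemma euler_genocchi_add:
  "euler_genocchi lam r (l + r) x = fact (l + r) * euler_genocchi_gf lam 0 x $ l"
  by (simp add: euler_genocchi_def euler_genocchi_gf_eq_X_power_mult[of lam r]
      fps_X_power_mult_nth)

theorem theorem1:
  fixes lam x :: real and r n :: nat
  assumes "lam \<noteq> 0"
  shows "gen_falling_factorial lam x n =
    1 / (2 * falling_factorial (real (n + r)) r) *
      ((\<Sum>l=0..n. real ((n + r) choose (l + r)) * gen_falling_factorial lam 1 (n - l)
          * euler_genocchi lam r (l + r) x)
        + euler_genocchi lam r (n + r) x)"
proof -
  let ?H = "euler_genocchi_gf lam 0 x"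
  \<comment> \<open>The functional equation at order 0. Its factor 2 is written as a sum so that
    \<open>fps_add_nth\<close> can extract the coefficient.\<close>
  have "(?H * deg_exp lam 1 + ?H) $ n = (deg_exp lam x + deg_exp lam x) $ n"
    using euler_genocchi_gf_mult[of lam 0 x] by (simp add: distrib_left flip: mult_2)
  then have coeff: "(\<Sum>l=0..n. ?H $ l * deg_exp lam 1 $ (n - l)) + ?H $ n =
      2 * gen_falling_factorial lam x n / fact n"
    unfolding fps_add_nth fps_mult_nth by (simp add: deg_exp_def)
  \<comment> \<open>The binomial is (n+r)! / ((l+r)! (n-l)!): here (l+r)! cancels against
    \<open>euler_genocchi_add\<close>, and (n-l)! is the denominator in the coefficient of
    \<open>deg_exp lam 1\<close>.\<close>
  have "(\<Sum>l=0..n. real ((n + r) choose (l + r)) * gen_falling_factorial lam 1 (n - l)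
          * euler_genocchi lam r (l + r) x) =
      (\<Sum>l=0..n. fact (n + r) * (?H $ l * deg_exp lam 1 $ (n - l)))"
    by (intro sum.cong)
      (auto simp: euler_genocchi_add binomial_fact deg_exp_def field_simps)
  then have "(\<Sum>l=0..n. real ((n + r) choose (l + r)) * gen_falling_factorial lam 1 (n - l)
          * euler_genocchi lam r (l + r) x) + euler_genocchi lam r (n + r) x =
      fact (n + r) * ((\<Sum>l=0..n. ?H $ l * deg_exp lam 1 $ (n - l)) + ?H $ n)"
    by (simp only: euler_genocchi_add sum_distrib_left distrib_left)
  also have "\<dots> = fact (n + r) * (2 * gen_falling_factorial lam x n / fact n)"
    by (simp only: coeff)
  finally show ?thesis
    unfolding falling_factorial_eq_fact_div by simp
qed

end
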